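(* Let $n \ge 0$ be an integer and let $M$ be a separable metric space with $H^{n+1}(M) = 0$. Then $M$ has topological dimension $\le n$.
   Context: Hausdorff measure: for a metric space $M$, $A \subseteq M$, $\alpha \ge 0$ and $0 < \delta \le \infty$, $H^\alpha_\delta(A)$ is the infimum of $\sum_i (\operatorname{diam} E_i)^\alpha$ over all coverings of $A$ by finitely or countably many subsets $E_i$ of $M$ with $\operatorname{diam} E_i < \delta$ for each $i$ (equal to $+\infty$ if there is no such covering), and $H^\alpha(A) = \sup_{\delta>0} H^\alpha_\delta(A)$. For $\alpha = 0$ the conventions are $(\operatorname{diam} \emptyset)^0 = 0$ and $(\operatorname{diam} E)^0 = 1$ for $E$ nonempty and bounded. There is no normalizing constant. Topological dimension (small inductive dimension): the empty set is considered to have topological dimension $-1$ (so only the empty space has topological dimension $\le -1$). Inductively, for an integer $n \ge 0$, a separable metric space $M$ has topological dimension $\le n$ if for every $p \in M$ and $r > 0$ there is an open set $U$ in $M$ with $p \in U \subseteq B(p,r)$ such that the boundary $\partial U$ has topological dimension $\le n-1$. Subsets of a metric space are regarded as metric spaces with the restricted metric. *)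

theory Defs
  imports "HOL-Analysis.Analysis"
begin

text \<open>
  The library's \<open>diameter\<close> is real-valued (unspecified on unbounded sets) and tied to the type
  class of metric spaces, hence this version; the empty set gets diameter \<open>0\<close>.
\<close>
definition mdiameter :: "'a metric \<Rightarrow> 'a set \<Rightarrow> ennreal" where
  "mdiameter m E = (SUP x\<in>E. SUP y\<in>E. ennreal (mdist m x y))"

text \<open>
  The power \<open>(diam E)\<^sup>\<alpha>\<close> for \<open>\<alpha> \<ge> 0\<close>.  The case split is needed because \<open>0 powr 0 = 0\<close>, whereas a
  nonempty set of diameter zero must count \<open>1\<close> when \<open>\<alpha> = 0\<close>.  Only sets of finite diameter matter,
  since the coverings below satisfy \<open>mdiameter m E < \<delta> \<le> \<infinity>\<close>.
\<close>
definition diam_power :: "'a metric \<Rightarrow> real \<Rightarrow> 'a set \<Rightarrow> ennreal" where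
  "diam_power m \<alpha> E =
     (if E = {} then 0 else if \<alpha> = 0 then 1 else ennreal (enn2real (mdiameter m E) powr \<alpha>))"

text \<open>
  A finite or countable covering is a family indexed by an arbitrary set \<open>I\<close> of natural numbers.
  The infimum of the empty set is \<open>\<infinity>\<close>.
\<close>
definition hausdorff_premeasure :: "'a metric \<Rightarrow> real \<Rightarrow> ennreal \<Rightarrow> 'a set \<Rightarrow> ennreal" where
  "hausdorff_premeasure m \<alpha> \<delta> A =
     Inf {(\<Sum>\<^sub>\<infinity>i\<in>I. diam_power m \<alpha> (E i)) | (I :: nat set) (E :: nat \<Rightarrow> 'a set).
            (\<forall>i\<in>I. E i \<subseteq> mspace m \<and> mdiameter m (E i) < \<delta>) \<and> A \<subseteq> (\<Union>i\<in>I. E i)}"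

definition hausdorff_measure :: "'a metric \<Rightarrow> real \<Rightarrow> 'a set \<Rightarrow> ennreal" where
  "hausdorff_measure m \<alpha> A = (SUP \<delta>\<in>{0<..}. hausdorff_premeasure m \<alpha> \<delta> A)"

text \<open>
  \<open>topdim_le m n\<close>: the space \<open>m\<close> has small inductive dimension at most \<open>n\<close>, where \<open>n \<ge> -1\<close>.
  Separability is not built in: it passes to subspaces, so it is enough to assume it of the
  ambient space.
\<close>
inductive topdim_le :: "'a metric \<Rightarrow> int \<Rightarrow> bool" where
  empty: "mspace m = {} \<Longrightarrow> topdim_le m (- 1)"
| step: "\<lbrakk>0 \<le> n;
     \<forall>p\<in>mspace m. \<forall>r>0. \<exists>U. openin (mtopology_of m) U \<and> p \<in> U \<and> U \<subseteq> mball_of m p r \<and>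
       topdim_le (submetric m (mtopology_of m frontier_of U)) (n - 1)\<rbrakk>
   \<Longrightarrow> topdim_le m n"

end

theory Submission
  imports Defs
begin

text \<open>
  The proof is Szpilrajn's. By induction on \<open>k\<close>, a space with vanishing \<open>k\<close>-dimensional measure has
  dimension at most \<open>k - 1\<close>. The \<open>0\<close>-dimensional measure of a nonempty set is at least \<open>1\<close>, so for
  \<open>k = 0\<close> the space is empty. For the step, the boundary of a ball around \<open>p\<close> of radius \<open>t\<close> lies in
  the sphere of radius \<open>t\<close>. If the \<open>(k + 1)\<close>-dimensional measure of the whole space vanishes, then
  almost every sphere around \<open>p\<close> is null for the \<open>k\<close>-dimensional measure. Hence arbitrarily small
  radii exist for which the induction hypothesis applies to the boundary of the ball.

  The statement on almost every sphere (lemma \<open>AE_slice_hausdorff_measure_eq_0\<close>) is the null case of Eilenberg's inequality and holds for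
  the level sets of any \<open>1\<close>-Lipschitz function \<open>f\<close>. A set \<open>E\<close> of diameter \<open>d\<close> meets the level \<open>t\<close>
  only if \<open>t\<close> lies in an interval of length \<open>2 * d\<close>. So the part that \<open>E\<close> contributes to coverings of
  the levels, \<open>d powr \<alpha>\<close> at each such \<open>t\<close>, has integral at most \<open>2 * d powr (\<alpha> + 1)\<close>. Summed over
  a covering (lemma \<open>slice_premeasure_bound\<close>), this bounds the integral over \<open>t\<close> of the \<open>\<alpha>\<close>-premeasure of the level by
  twice the \<open>(\<alpha> + 1)\<close>-sum of the covering, which can be made arbitrarily small.
\<close>

section \<open>Coverings\<close>

lemma infsum_ennreal_eq_suminf:
  fixes g :: "nat \<Rightarrow> ennreal"
  shows "(\<Sum>\<^sub>\<infinity>i\<in>I. g i) = (\<Sum>i. g i * indicator I i)"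
proof -
  have "(\<Sum>\<^sub>\<infinity>i\<in>I. g i) = (\<Sum>\<^sub>\<infinity>i. g i * indicator I i)"
    by (rule infsum_cong_neutral) auto
  moreover have "((\<lambda>i. g i * indicator I i) has_sum (\<Sum>\<^sub>\<infinity>i. g i * indicator I i)) UNIV"
    by (intro has_sum_infsum nonneg_summable_on_complete) simp
  ultimately show ?thesis
    using has_sum_imp_sums sums_unique by metis
qed

lemma infsum_ennreal_mono:
  fixes g h :: "nat \<Rightarrow> ennreal"
  assumes "\<And>i. i \<in> I \<Longrightarrow> g i \<le> h i"
  shows "(\<Sum>\<^sub>\<infinity>i\<in>I. g i) \<le> (\<Sum>\<^sub>\<infinity>i\<in>I. h i)"
  using assms by (intro infsum_mono nonneg_summable_on_complete) auto

lemma mdiameter_mono: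
  assumes "E \<subseteq> F"
  shows "mdiameter m E \<le> mdiameter m F"
  unfolding mdiameter_def using assms by (intro SUP_subset_mono) auto

lemma mdist_le_mdiameter:
  assumes "x \<in> E" "y \<in> E" "mdiameter m E < \<infinity>"
  shows "mdist m x y \<le> enn2real (mdiameter m E)"
proof -
  have "ennreal (mdist m x y) \<le> mdiameter m E"
    unfolding mdiameter_def using assms(1,2) by (meson SUP_upper2 order_refl)
  also have "\<dots> = ennreal (enn2real (mdiameter m E))"
    using assms(3) by simp
  finally show ?thesis
    by (simp add: ennreal_le_iff)
qed

lemma diam_power_mono:
  assumes "E \<subseteq> F" "0 \<le> \<alpha>" "mdiameter m F < \<infinity>"
  shows "diam_power m \<alpha> E \<le> diam_power m \<alpha> F"
proof -
  have "enn2real (mdiameter m E) \<le> enn2real (mdiameter m F)"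
    using assms mdiameter_mono by (intro enn2real_mono) auto
  then have "enn2real (mdiameter m E) powr \<alpha> \<le> enn2real (mdiameter m F) powr \<alpha>"
    using assms(2) by (intro powr_mono2) auto
  then show ?thesis
    using assms(1) by (auto simp: diam_power_def intro: ennreal_leI)
qed

lemma diam_power_add_one:
  assumes "0 \<le> \<alpha>"
  shows "diam_power m \<alpha> E * ennreal (enn2real (mdiameter m E)) = diam_power m (\<alpha> + 1) E"
  using assms by (auto simp: diam_power_def powr_add simp flip: ennreal_mult)

lemma hausdorff_premeasure_le:
  fixes I :: "nat set"
  assumes "\<And>i. i \<in> I \<Longrightarrow> E i \<subseteq> mspace m" "\<And>i. i \<in> I \<Longrightarrow> mdiameter m (E i) < \<delta>"
    and "A \<subseteq> (\<Union>i\<in>I. E i)"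
  shows "hausdorff_premeasure m \<alpha> \<delta> A \<le> (\<Sum>\<^sub>\<infinity>i\<in>I. diam_power m \<alpha> (E i))"
  unfolding hausdorff_premeasure_def using assms by (intro Inf_lower CollectI exI[of _ I] exI[of _ E]) auto

lemma hausdorff_premeasure_less_cover:
  assumes "hausdorff_premeasure m \<alpha> \<delta> A < c"
  obtains I :: "nat set" and E :: "nat \<Rightarrow> 'a set"
  where "\<And>i. i \<in> I \<Longrightarrow> E i \<subseteq> mspace m" "\<And>i. i \<in> I \<Longrightarrow> mdiameter m (E i) < \<delta>"
    and "A \<subseteq> (\<Union>i\<in>I. E i)" "(\<Sum>\<^sub>\<infinity>i\<in>I. diam_power m \<alpha> (E i)) < c"
  using assms unfolding hausdorff_premeasure_def Inf_less_iff by blast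

lemma hausdorff_premeasure_antimono_scale:
  assumes "\<delta> \<le> \<delta>'"
  shows "hausdorff_premeasure m \<alpha> \<delta>' A \<le> hausdorff_premeasure m \<alpha> \<delta> A"
proof (rule dense_ge)
  fix c assume "hausdorff_premeasure m \<alpha> \<delta> A < c"
  then obtain I :: "nat set" and E where E: "\<And>i. i \<in> I \<Longrightarrow> E i \<subseteq> mspace m" "\<And>i. i \<in> I \<Longrightarrow> mdiameter m (E i) < \<delta>"
    and cov: "A \<subseteq> (\<Union>i\<in>I. E i)" and sum: "(\<Sum>\<^sub>\<infinity>i\<in>I. diam_power m \<alpha> (E i)) < c"
    by (rule hausdorff_premeasure_less_cover) blast
  show "hausdorff_premeasure m \<alpha> \<delta>' A \<le> c"
    using hausdorff_premeasure_le[OF E(1) order.strict_trans2[OF E(2) assms] cov] sum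
    by (meson order.strict_implies_order order_trans)
qed

lemma hausdorff_measure_eq_0_iff:
  "hausdorff_measure m \<alpha> A = 0 \<longleftrightarrow> (\<forall>\<delta>>0. hausdorff_premeasure m \<alpha> \<delta> A = 0)"
  by (auto simp: hausdorff_measure_def simp flip: bot_ennreal)

text \<open>
  For \<open>\<alpha> = 0\<close> every nonempty member of a covering costs \<open>1\<close>, so a covering of total cost below \<open>1\<close>
  has only empty members.
\<close>
lemma hausdorff_measure_zero_empty:
  assumes "hausdorff_measure m 0 A = 0"
  shows "A = {}"
proof -
  have "hausdorff_premeasure m 0 1 A < 1"
    using assms by (simp add: hausdorff_measure_eq_0_iff)
  then obtain I :: "nat set" and E where cov: "A \<subseteq> (\<Union>i\<in>I. E i)" "(\<Sum>\<^sub>\<infinity>i\<in>I. diam_power m 0 (E i)) < 1"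
    by (rule hausdorff_premeasure_less_cover) blast
  have "E i = {}" if "i \<in> I" for i
  proof -
    have "diam_power m 0 (E i) = (\<Sum>\<^sub>\<infinity>j\<in>{i}. diam_power m 0 (E j))"
      by simp
    also have "\<dots> \<le> (\<Sum>\<^sub>\<infinity>j\<in>I. diam_power m 0 (E j))"
      using that by (intro infsum_mono_neutral nonneg_summable_on_complete) auto
    also note cov(2)
    finally show ?thesis
      by (simp add: diam_power_def split: if_splits)
  qed
  with cov(1) show ?thesis
    by auto
qed

text \<open>
  The members of a covering in a subspace must lie in that subspace. Intersecting the members of
  an ambient covering with it does not increase diameters, so it costs nothing here to measure \<open>S\<close>
  intrinsically.
\<close>
lemma hausdorff_premeasure_submetric_le:
  assumes "0 \<le> \<alpha>" "S \<subseteq> A"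
  shows "hausdorff_premeasure (submetric m S) \<alpha> \<delta> (S \<inter> mspace m) \<le> hausdorff_premeasure m \<alpha> \<delta> A"
proof (rule dense_ge)
  fix c assume "hausdorff_premeasure m \<alpha> \<delta> A < c"
  then obtain I :: "nat set" and E where E: "\<And>i. i \<in> I \<Longrightarrow> E i \<subseteq> mspace m" "\<And>i. i \<in> I \<Longrightarrow> mdiameter m (E i) < \<delta>"
    and cov: "A \<subseteq> (\<Union>i\<in>I. E i)" and sum: "(\<Sum>\<^sub>\<infinity>i\<in>I. diam_power m \<alpha> (E i)) < c"
    by (rule hausdorff_premeasure_less_cover) blast
  have diam: "mdiameter (submetric m S) = mdiameter m"
    by (simp add: mdiameter_def fun_eq_iff)
  have dp: "diam_power (submetric m S) = diam_power m"
    by (simp add: diam_power_def fun_eq_iff diam)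
  have "hausdorff_premeasure (submetric m S) \<alpha> \<delta> (S \<inter> mspace m)
      \<le> (\<Sum>\<^sub>\<infinity>i\<in>I. diam_power (submetric m S) \<alpha> (S \<inter> E i))"
  proof (rule hausdorff_premeasure_le)
    show "mdiameter (submetric m S) (S \<inter> E i) < \<delta>" if "i \<in> I" for i
      unfolding diam using E(2)[OF that] mdiameter_mono[of "S \<inter> E i" "E i" m] by auto
  qed (use E(1) cov assms(2) in auto)
  also have "\<dots> \<le> (\<Sum>\<^sub>\<infinity>i\<in>I. diam_power m \<alpha> (E i))"
    unfolding dp
    using assms(1) order.strict_trans2[OF E(2) top_greatest]
    by (intro infsum_ennreal_mono diam_power_mono) auto
  also note sum
  finally show "hausdorff_premeasure (submetric m S) \<alpha> \<delta> (S \<inter> mspace m) \<le> c"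
    by simp
qed

lemma hausdorff_measure_submetric_eq_0:
  assumes "0 \<le> \<alpha>" "S \<subseteq> A" "hausdorff_measure m \<alpha> A = 0"
  shows "hausdorff_measure (submetric m S) \<alpha> (mspace (submetric m S)) = 0"
  unfolding hausdorff_measure_eq_0_iff mspace_submetric
proof (intro allI impI)
  fix \<delta> :: ennreal assume "\<delta> > 0"
  then have "hausdorff_premeasure m \<alpha> \<delta> A = 0"
    using assms(3) by (simp add: hausdorff_measure_eq_0_iff)
  then show "hausdorff_premeasure (submetric m S) \<alpha> \<delta> (S \<inter> mspace m) = 0"
    using hausdorff_premeasure_submetric_le[OF assms(1,2), of m \<delta>] by simp
qed

section \<open>Slicing by the level sets of a Lipschitz function\<close>

text \<open>
  Any point \<open>x\<close> of \<open>E\<close> serves as a centre: \<open>f ` E\<close> lies within \<open>diam E\<close> of \<open>f x\<close>. The interval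
  replaces \<open>f ` E\<close> because the latter may fail to be measurable.
\<close>
lemma lipschitz_image_in_interval:
  fixes f :: "'a \<Rightarrow> real"
  assumes lip: "\<And>x y. x \<in> mspace m \<Longrightarrow> y \<in> mspace m \<Longrightarrow> \<bar>f x - f y\<bar> \<le> mdist m x y"
    and "0 \<le> \<alpha>" and E: "E \<subseteq> mspace m" "mdiameter m E < \<infinity>"
  obtains a b where "a \<le> b" "f ` E \<subseteq> {a..b}"
    "diam_power m \<alpha> E * ennreal (b - a) \<le> 2 * diam_power m (\<alpha> + 1) E"
proof (cases "E = {}")
  case True
  then show ?thesis
    using that[of 0 0] by simp
next
  case False
  then obtain x where x: "x \<in> E"
    by blast
  define d where "d = enn2real (mdiameter m E)"
  have "d \<ge> 0"
    by (simp add: d_def)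
  have "\<bar>f x - f y\<bar> \<le> d" if "y \<in> E" for y
    unfolding d_def using lip mdist_le_mdiameter[OF x that E(2)] E(1) x that
    by (meson order_trans subsetD)
  then have img: "f ` E \<subseteq> {f x - d..f x + d}"
    by (fastforce simp: abs_le_iff)
  have "diam_power m \<alpha> E * ennreal ((f x + d) - (f x - d)) = 2 * (diam_power m \<alpha> E * ennreal d)"
    using \<open>d \<ge> 0\<close> by (simp add: ennreal_mult' mult_2[symmetric] mult_ac)
  also have "\<dots> = 2 * diam_power m (\<alpha> + 1) E"
    unfolding d_def diam_power_add_one[OF \<open>0 \<le> \<alpha>\<close>] ..
  finally show ?thesis
    using that[OF _ img] \<open>d \<ge> 0\<close> by simp
qed

text \<open>
  The premeasure of the level set need not depend measurably on \<open>t\<close>, so the bound on its integral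
  is expressed through a measurable majorant \<open>h\<close>: the sum of the costs of those members of the
  covering whose interval contains \<open>t\<close>.
\<close>
lemma slice_premeasure_bound:
  fixes f :: "'a \<Rightarrow> real"
  assumes lip: "\<And>x y. x \<in> mspace m \<Longrightarrow> y \<in> mspace m \<Longrightarrow> \<bar>f x - f y\<bar> \<le> mdist m x y"
    and "0 \<le> \<alpha>" and less: "hausdorff_premeasure m (\<alpha> + 1) \<delta> A < c"
  obtains h where "h \<in> borel_measurable lborel" "(\<integral>\<^sup>+t. h t \<partial>lborel) \<le> 2 * c"
    "\<And>t. hausdorff_premeasure m \<alpha> \<delta> {x\<in>A. f x = t} \<le> h t"
proof -
  obtain I :: "nat set" and E where E: "\<And>i. i \<in> I \<Longrightarrow> E i \<subseteq> mspace m" "\<And>i. i \<in> I \<Longrightarrow> mdiameter m (E i) < \<delta>"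
    and cov: "A \<subseteq> (\<Union>i\<in>I. E i)" and sum: "(\<Sum>\<^sub>\<infinity>i\<in>I. diam_power m (\<alpha> + 1) (E i)) < c"
    using less by (rule hausdorff_premeasure_less_cover) blast
  have "\<exists>a b. a \<le> b \<and> f ` E i \<subseteq> {a..b} \<and>
      diam_power m \<alpha> (E i) * ennreal (b - a) \<le> 2 * diam_power m (\<alpha> + 1) (E i)" if "i \<in> I" for i
  proof -
    have "mdiameter m (E i) < \<infinity>"
      using order.strict_trans2[OF E(2)[OF that] top_greatest] by simp
    then show ?thesis
      using lipschitz_image_in_interval[OF lip \<open>0 \<le> \<alpha>\<close> E(1)[OF that]] by metis
  qed
  then obtain a b where ab: "\<And>i. i \<in> I \<Longrightarrow> a i \<le> b i" "\<And>i. i \<in> I \<Longrightarrow> f ` E i \<subseteq> {a i..b i}"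
    "\<And>i. i \<in> I \<Longrightarrow> diam_power m \<alpha> (E i) * ennreal (b i - a i) \<le> 2 * diam_power m (\<alpha> + 1) (E i)"
    by metis
  define h where "h = (\<lambda>t. \<Sum>i. diam_power m \<alpha> (E i) * indicator I i * indicator {a i..b i} t)"
  show thesis
  proof
    show "h \<in> borel_measurable lborel"
      unfolding h_def by measurable
    have "(\<integral>\<^sup>+t. h t \<partial>lborel) =
        (\<Sum>i. diam_power m \<alpha> (E i) * indicator I i * emeasure lborel {a i..b i})"
      unfolding h_def by (simp add: nn_integral_suminf nn_integral_cmult)
    also have "\<dots> \<le> (\<Sum>i. 2 * (diam_power m (\<alpha> + 1) (E i) * indicator I i))"
      using ab by (intro suminf_le) (auto simp: indicator_def)
    also have "\<dots> = 2 * (\<Sum>\<^sub>\<infinity>i\<in>I. diam_power m (\<alpha> + 1) (E i))"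
      by (simp add: infsum_ennreal_eq_suminf)
    also have "\<dots> \<le> 2 * c"
      using sum by (intro mult_left_mono) auto
    finally show "(\<integral>\<^sup>+t. h t \<partial>lborel) \<le> 2 * c" .
    show "hausdorff_premeasure m \<alpha> \<delta> {x\<in>A. f x = t} \<le> h t" for t
    proof -
      define J where "J = {i\<in>I. t \<in> f ` E i}"
      have "hausdorff_premeasure m \<alpha> \<delta> {x\<in>A. f x = t} \<le> (\<Sum>\<^sub>\<infinity>i\<in>J. diam_power m \<alpha> (E i))"
      proof (rule hausdorff_premeasure_le)
        show "{x\<in>A. f x = t} \<subseteq> (\<Union>i\<in>J. E i)"
          using cov by (fastforce simp: J_def)
      qed (use E in \<open>auto simp: J_def\<close>)
      also have "\<dots> = (\<Sum>i. diam_power m \<alpha> (E i) * indicator J i)"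
        by (rule infsum_ennreal_eq_suminf)
      also have "\<dots> \<le> h t"
        unfolding h_def using ab(2)
        by (intro suminf_le) (auto simp: J_def indicator_def image_subset_iff)
      finally show ?thesis .
    qed
  qed
qed

text \<open>
  The pointwise infimum of majorants with integrals tending to \<open>0\<close> is a majorant with integral \<open>0\<close>,
  hence vanishes almost everywhere.
\<close>
lemma AE_slice_premeasure_eq_0:
  fixes f :: "'a \<Rightarrow> real"
  assumes lip: "\<And>x y. x \<in> mspace m \<Longrightarrow> y \<in> mspace m \<Longrightarrow> \<bar>f x - f y\<bar> \<le> mdist m x y"
    and "0 \<le> \<alpha>" and zero: "hausdorff_premeasure m (\<alpha> + 1) \<delta> A = 0"
  shows "AE t in lborel. hausdorff_premeasure m \<alpha> \<delta> {x\<in>A. f x = t} = 0"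
proof -
  have "\<exists>h. h \<in> borel_measurable lborel \<and> (\<integral>\<^sup>+t. h t \<partial>lborel) \<le> 2 * ennreal (1 / Suc k) \<and>
      (\<forall>t. hausdorff_premeasure m \<alpha> \<delta> {x\<in>A. f x = t} \<le> h t)" for k
  proof -
    have less: "hausdorff_premeasure m (\<alpha> + 1) \<delta> A < ennreal (1 / Suc k)"
      by (simp add: zero)
    obtain h where "h \<in> borel_measurable lborel"
      "(\<integral>\<^sup>+t. h t \<partial>lborel) \<le> 2 * ennreal (1 / Suc k)"
      "\<And>t. hausdorff_premeasure m \<alpha> \<delta> {x\<in>A. f x = t} \<le> h t"
      by (rule slice_premeasure_bound[OF lip \<open>0 \<le> \<alpha>\<close> less]) blast+
    then show ?thesis
      by blast
  qed
  then obtain h where h: "\<And>k. h k \<in> borel_measurable lborel"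
    "\<And>k. (\<integral>\<^sup>+t. h k t \<partial>lborel) \<le> 2 * ennreal (1 / Suc k)"
    "\<And>k t. hausdorff_premeasure m \<alpha> \<delta> {x\<in>A. f x = t} \<le> h k t"
    by metis
  define g where "g = (\<lambda>t. INF k. h k t)"
  have meas: "g \<in> borel_measurable lborel"
    unfolding g_def using h(1) by (intro borel_measurable_INF) auto
  have "(\<integral>\<^sup>+t. g t \<partial>lborel) \<le> 2 * ennreal (1 / Suc k)" for k
  proof -
    have "(\<integral>\<^sup>+t. g t \<partial>lborel) \<le> (\<integral>\<^sup>+t. h k t \<partial>lborel)"
      unfolding g_def by (intro nn_integral_mono INF_lower) auto
    with h(2) show ?thesis
      by (rule order_trans[rotated])
  qed
  moreover have "(\<lambda>k. 2 * ennreal (1 / Suc k)) \<longlonglongrightarrow> 2 * ennreal 0"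
    by (intro ennreal_tendsto_cmult tendsto_ennrealI LIMSEQ_Suc[OF lim_1_over_n]) auto
  ultimately have "(\<integral>\<^sup>+t. g t \<partial>lborel) \<le> 2 * ennreal 0"
    by (intro LIMSEQ_le_const) auto
  then have "AE t in lborel. g t = 0"
    using nn_integral_0_iff_AE[OF meas] by simp
  moreover have "hausdorff_premeasure m \<alpha> \<delta> {x\<in>A. f x = t} \<le> g t" for t
    unfolding g_def using h(3) by (intro INF_greatest) auto
  ultimately show ?thesis
    by (auto elim!: eventually_mono) (metis le_zero_eq)
qed

text \<open>
  The exceptional null set of the previous lemma depends on the scale \<open>\<delta>\<close>; since the premeasures
  are monotone in \<open>\<delta>\<close>, countably many scales tending to \<open>0\<close> suffice.
\<close>
lemma AE_slice_hausdorff_measure_eq_0: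
  fixes f :: "'a \<Rightarrow> real"
  assumes lip: "\<And>x y. x \<in> mspace m \<Longrightarrow> y \<in> mspace m \<Longrightarrow> \<bar>f x - f y\<bar> \<le> mdist m x y"
    and "0 \<le> \<alpha>" and zero: "hausdorff_measure m (\<alpha> + 1) A = 0"
  shows "AE t in lborel. hausdorff_measure m \<alpha> {x\<in>A. f x = t} = 0"
proof -
  let ?H = "\<lambda>\<delta> t. hausdorff_premeasure m \<alpha> \<delta> {x\<in>A. f x = t}"
  have "AE t in lborel. \<forall>k. ?H (ennreal (1 / Suc k)) t = 0"
    unfolding AE_all_countable using zero
    by (intro allI AE_slice_premeasure_eq_0[OF lip \<open>0 \<le> \<alpha>\<close>]) (auto simp: hausdorff_measure_eq_0_iff)
  then show ?thesis
  proof (rule eventually_mono)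
    fix t assume t: "\<forall>k. ?H (ennreal (1 / Suc k)) t = 0"
    have "?H \<delta> t = 0" if "\<delta> > 0" for \<delta>
    proof -
      have "(\<lambda>k. ennreal (1 / Suc k)) \<longlonglongrightarrow> ennreal 0"
        by (intro tendsto_ennrealI LIMSEQ_Suc[OF lim_1_over_n])
      then have "eventually (\<lambda>k. ennreal (1 / Suc k) < \<delta>) sequentially"
        using that by (intro order_tendstoD) auto
      then obtain k where "ennreal (1 / Suc k) < \<delta>"
        by (auto dest: eventually_happens)
      then have "?H \<delta> t \<le> ?H (ennreal (1 / Suc k)) t"
        by (intro hausdorff_premeasure_antimono_scale) simp
      with t show ?thesis
        by simp
    qed
    then show "hausdorff_measure m \<alpha> {x\<in>A. f x = t} = 0"
      by (simp add: hausdorff_measure_eq_0_iff)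
  qed
qed

section \<open>Dimension of a null space\<close>

lemma frontier_of_mball_subset_sphere:
  "mtopology_of m frontier_of mball_of m p r \<subseteq> {x \<in> mspace m. mdist m p x = r}"
proof -
  interpret Metric_space "mspace m" "mdist m"
    by simp
  have ball: "mball_of m p r = mball p r"
    by (simp add: mball_of_def)
  have top: "mtopology_of m = mtopology"
    by (simp add: mtopology_of_def)
  have "mtopology closure_of mball p r \<subseteq> mcball p r"
    by (intro closure_of_minimal mball_subset_mcball closedin_mcball)
  moreover have "mtopology interior_of mball p r = mball p r"
    by (simp add: interior_of_openin)
  ultimately show ?thesis
    by (auto simp: ball top frontier_of_def)
qed

text \<open>
  The index is shifted by one against the theorem so that the induction starts at the empty space
  of dimension \<open>- 1\<close>, and the case of dimension \<open>0\<close> needs no separate argument.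
\<close>
lemma topdim_le_of_hausdorff_null:
  assumes "hausdorff_measure m (real k) (mspace m) = 0"
  shows "topdim_le m (int k - 1)"
  using assms
proof (induction k arbitrary: m)
  case 0
  then show ?case
    using hausdorff_measure_zero_empty[of m "mspace m"] topdim_le.empty[of m] by simp
next
  case (Suc k)
  have "\<exists>U. openin (mtopology_of m) U \<and> p \<in> U \<and> U \<subseteq> mball_of m p r \<and>
      topdim_le (submetric m (mtopology_of m frontier_of U)) (int k - 1)"
    if p: "p \<in> mspace m" and "r > 0" for p r
  proof -
    let ?S = "\<lambda>t. {x \<in> mspace m. mdist m p x = t}"
    interpret Metric_space "mspace m" "mdist m"
      by simp
    have "\<bar>mdist m p x - mdist m p y\<bar> \<le> mdist m x y" if "x \<in> mspace m" "y \<in> mspace m" for x y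
      using mdist_reverse_triangle[OF that(1) p that(2)] by (simp add: mdist_commute)
    then have ae: "AE t in lborel. hausdorff_measure m (real k) (?S t) = 0"
      using Suc.prems by (intro AE_slice_hausdorff_measure_eq_0) (auto simp: add.commute)
    have "\<exists>t\<in>{0<..<r}. hausdorff_measure m (real k) (?S t) = 0"
    proof (rule ccontr)
      assume "\<not> ?thesis"
      with ae have "AE t in lborel. t \<notin> {0<..<r}"
        by (auto elim: eventually_mono)
      then have "emeasure lborel {0<..<r} = 0"
        by (subst (asm) AE_iff_measurable[of "{0<..<r}"]) auto
      with \<open>r > 0\<close> show False
        by simp
    qed
    then obtain t where t: "0 < t" "t < r" and null: "hausdorff_measure m (real k) (?S t) = 0"
      by auto
    let ?U = "mball_of m p t"
    show ?thesis
    proof (intro exI[of _ ?U] conjI)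
      show "openin (mtopology_of m) ?U"
        by (simp add: mball_of_def mtopology_of_def)
      show "p \<in> ?U" "?U \<subseteq> mball_of m p r"
        using p t by auto
      show "topdim_le (submetric m (mtopology_of m frontier_of ?U)) (int k - 1)"
        by (intro Suc.IH hausdorff_measure_submetric_eq_0[OF _ frontier_of_mball_subset_sphere null])
          simp
    qed
  qed
  then show ?case
    by (intro topdim_le.step) auto
qed

theorem mainTheorem1:
  fixes m :: "'a metric" and n :: nat
  assumes "separable_space (mtopology_of m)"
    and "hausdorff_measure m (real n + 1) (mspace m) = 0"
  shows "topdim_le m (int n)"
  using topdim_le_of_hausdorff_null[of m "Suc n"] assms(2) by (simp add: add.commute)

end
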